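(* The price of fixed assignments of SEBP equals $1+e^{-1}$: $$\sup_I\frac{OPT_{\mathcal F}(I)}{OPT_{\mathcal P}(I)}=1+e^{-1},$$ where the supremum is over all instances $I$ of SEBP.
   Context: Stochastic extensible bin packing (SEBP): an instance $I=(\vec P,m)$ consists of $m$ identical machines $\mathcal M$, each with unit regular capacity, and $n$ jobs whose processing times $P_1,\dots,P_n$ are mutually independent nonnegative random variables with finite expectations. A scheduling policy maps each realization to a feasible schedule (start times and machine assignments such that no machine processes two jobs at once) in a non-anticipatory way (decisions at time $t$ depend only on durations of jobs completed before $t$ and on conditional distributions of the others). For a policy $\Pi$ the workload $X_i^\Pi$ of machine $i$ is the latest completion time of a job on $i$, and the cost is $\Phi(\Pi)=\mathbb E[\sum_i\max(X_i^\Pi,1)]$. $OPT_{\mathcal P}(I)$ is the infimum of $\Phi$ over all scheduling policies; $OPT_{\mathcal F}(I)$ is the infimum of $\Phi$ over non-idling fixed-assignment policies, i.e. over assignments $\vec a\in\mathcal M^n$ fixed independently of the realization, with cost $\sum_i\mathbb E[\max(\sum_{j:a_j=i}P_j,1)]$. *)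

theory Defs
  imports "HOL-Probability.Probability"
begin

text \<open>
  Jobs are \<open>{..<njobs I}\<close> and machines are \<open>{..<nmachines I}\<close>. All costs depend only on the joint
  law of the processing times, which by mutual independence is the product of their individual
  laws; so an instance carries the law of each \<open>P\<^sub>j\<close>, and the processing times are the coordinates
  of the product space.
\<close>

record sebp =
  njobs :: nat
  nmachines :: nat
  law :: "nat \<Rightarrow> real measure"

definition sebp_instance :: "sebp \<Rightarrow> bool" where
  "sebp_instance I \<longleftrightarrow>
     0 < nmachines I \<and>
     (\<forall>j<njobs I. prob_space (law I j) \<and> sets (law I j) = sets borel \<and>
        (AE x in law I j. 0 \<le> x) \<and> integrable (law I j) (\<lambda>x. x))"

definition joint_law :: "sebp \<Rightarrow> (nat \<Rightarrow> real) measure" where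
  "joint_law I = PiM {..<njobs I} (law I)"

definition realizations :: "nat \<Rightarrow> (nat \<Rightarrow> real) set" where
  "realizations n = {..<n} \<rightarrow>\<^sub>E {0..}"

record schedule =
  start :: "nat \<Rightarrow> real"
  machine :: "nat \<Rightarrow> nat"

definition feasible :: "nat \<Rightarrow> nat \<Rightarrow> (nat \<Rightarrow> real) \<Rightarrow> schedule \<Rightarrow> bool" where
  "feasible n m p S \<longleftrightarrow>
     (\<forall>j<n. 0 \<le> start S j \<and> machine S j < m) \<and>
     (\<forall>j<n. \<forall>k<n. j \<noteq> k \<and> machine S j = machine S k \<longrightarrow>
        {start S j ..< start S j + p j} \<inter> {start S k ..< start S k + p k} = {})"

text \<open>
  Decisions are taken at moments \<open>(t, k)\<close>, ordered lexicographically: \<open>t\<close> is the time, and the stage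
  \<open>k\<close> orders several decisions taken at the same time. Stages are needed because durations may be
  \<open>0\<close>: a machine may start a job, see it complete at once, and start the next one at the same time,
  as a non-idling fixed assignment does. The decision for a job is never based on its own duration,
  since \<open>history\<close> only contains jobs started at strictly earlier moments. For a job that has been
  started but is not completed by time \<open>t\<close> one only knows that its duration exceeds the time elapsed
  since its start.
\<close>

definition history ::
    "nat \<Rightarrow> (nat \<Rightarrow> real) \<Rightarrow> schedule \<Rightarrow> (nat \<Rightarrow> nat) \<Rightarrow> real \<Rightarrow> nat \<Rightarrow>
     nat \<Rightarrow> (real \<times> nat \<times> nat \<times> real option) option" where
  "history n p S r t k = (\<lambda>j.
     if j < n \<and> (start S j < t \<or> start S j = t \<and> r j < k)
     then Some (start S j, r j, machine S j,
                if start S j + p j \<le> t then Some (p j) else None)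
     else None)"

definition decision :: "nat \<Rightarrow> schedule \<Rightarrow> (nat \<Rightarrow> nat) \<Rightarrow> real \<Rightarrow> nat \<Rightarrow> (nat \<times> nat) set" where
  "decision n S r t k = {(j, machine S j) | j. j < n \<and> start S j = t \<and> r j = k}"

definition non_anticipatory :: "nat \<Rightarrow> ((nat \<Rightarrow> real) \<Rightarrow> schedule) \<Rightarrow> bool" where
  "non_anticipatory n \<pi> \<longleftrightarrow>
     (\<exists>r :: (nat \<Rightarrow> real) \<Rightarrow> nat \<Rightarrow> nat.
        \<forall>p \<in> realizations n. \<forall>q \<in> realizations n. \<forall>t k.
          history n p (\<pi> p) (r p) t k = history n q (\<pi> q) (r q) t k \<longrightarrow>
          decision n (\<pi> p) (r p) t k = decision n (\<pi> q) (r q) t k)"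

text \<open>
  Measurability is what makes the expected cost meaningful. Requiring it on all of \<open>\<real>\<^sup>n\<close> rather than
  on the nonnegative vectors is no restriction: a policy may be extended by a constant.
\<close>

definition policy :: "nat \<Rightarrow> nat \<Rightarrow> ((nat \<Rightarrow> real) \<Rightarrow> schedule) \<Rightarrow> bool" where
  "policy n m \<pi> \<longleftrightarrow>
     (\<forall>j<n. (\<lambda>p. start (\<pi> p) j) \<in> PiM {..<n} (\<lambda>_. borel) \<rightarrow>\<^sub>M borel \<and>
            (\<lambda>p. machine (\<pi> p) j) \<in> PiM {..<n} (\<lambda>_. borel) \<rightarrow>\<^sub>M count_space UNIV) \<and>
     (\<forall>p \<in> realizations n. feasible n m p (\<pi> p)) \<and>
     non_anticipatory n \<pi>"

text \<open>The workload of a machine that receives no job is \<open>0\<close>.\<close>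

definition workload :: "nat \<Rightarrow> (nat \<Rightarrow> real) \<Rightarrow> schedule \<Rightarrow> nat \<Rightarrow> real" where
  "workload n p S i = Max (insert 0 {start S j + p j | j. j < n \<and> machine S j = i})"

text \<open>
  Expectations are taken in the extended nonnegative reals, so that a policy of infinite expected
  cost really has cost \<open>\<infinity>\<close>.
\<close>

definition cost :: "sebp \<Rightarrow> ((nat \<Rightarrow> real) \<Rightarrow> schedule) \<Rightarrow> ennreal" where
  "cost I \<pi> =
     (\<integral>\<^sup>+ p. ennreal (\<Sum>i<nmachines I. max (workload (njobs I) p (\<pi> p) i) 1) \<partial>joint_law I)"

definition OPT_P :: "sebp \<Rightarrow> ennreal" where
  "OPT_P I = (INF \<pi> \<in> {\<pi>. policy (njobs I) (nmachines I) \<pi>}. cost I \<pi>)"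

definition fixed_cost :: "sebp \<Rightarrow> (nat \<Rightarrow> nat) \<Rightarrow> ennreal" where
  "fixed_cost I a =
     (\<Sum>i<nmachines I. \<integral>\<^sup>+ p. ennreal (max (\<Sum>j | j < njobs I \<and> a j = i. p j) 1) \<partial>joint_law I)"

definition OPT_F :: "sebp \<Rightarrow> ennreal" where
  "OPT_F I = (INF a \<in> {..<njobs I} \<rightarrow>\<^sub>E {..<nmachines I}. fixed_cost I a)"

end

theory Submission
  imports Defs
begin

text \<open>
  Write \<open>\<mu>\<^sub>j\<close> for the mean of \<open>min P\<^sub>j 1\<close>, \<open>M\<close> for the sum of the \<open>\<mu>\<^sub>j\<close>, and \<open>E\<close> for the sum of the
  means of \<open>max (P\<^sub>j - 1) 0\<close>. On every schedule a machine processing a set \<open>A\<close> of jobs costs at least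
  the sum of \<open>P\<^sub>j\<close> over \<open>A\<close> and at least one plus the sum of \<open>max (P\<^sub>j - 1) 0\<close> over \<open>A\<close>, so every
  policy costs at least \<open>E + max m M\<close>. A fixed assignment of \<open>A\<close> to a machine costs at most the sum of
  \<open>P\<^sub>j\<close> plus the product of \<open>1 - min P\<^sub>j 1\<close>, by Weierstrass' product inequality. By independence, a
  uniformly random assignment has expected cost at most
  \<open>E + M + m \<Prod>\<^sub>j (1 - \<mu>\<^sub>j / m) \<le> E + M + m exp (- M / m) \<le> (1 + exp (- 1)) (E + max m M)\<close>.

  The bound is approached by \<open>N m\<close> jobs that are \<open>1\<close> with probability \<open>1 / N\<close> and \<open>0\<close> otherwise. An
  adaptive policy pays \<open>max Z m\<close>, where the total \<open>Z\<close> has mean \<open>m\<close> and variance at most \<open>m\<close>, while a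
  fixed assignment of \<open>k\<^sub>i\<close> jobs to machine \<open>i\<close> pays \<open>m + \<Sum>\<^sub>i (1 - 1 / N) ^ k\<^sub>i \<ge> m (1 + (1 - 1 / N) ^ N)\<close>
  by convexity.
\<close>

subsection \<open>Random assignments and the upper bound\<close>

lemma integral_PiM_prod:
  fixes f :: "'i \<Rightarrow> 'a \<Rightarrow> real"
  assumes fin: "finite I" and prob: "\<And>i. i \<in> I \<Longrightarrow> prob_space (M i)"
    and J: "J \<subseteq> I" and int: "\<And>i. i \<in> J \<Longrightarrow> integrable (M i) (f i)"
  shows "integrable (PiM I M) (\<lambda>x. \<Prod>i\<in>J. f i (x i))"
    and "(\<integral>x. (\<Prod>i\<in>J. f i (x i)) \<partial>PiM I M) = (\<Prod>i\<in>J. integral\<^sup>L (M i) (f i))"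
proof -
  define M' where "M' i = (if i \<in> I then M i else return (count_space UNIV) undefined)" for i
  define g where "g i = (if i \<in> J then f i else (\<lambda>_. 1))" for i
  have M': "prob_space (M' i)" for i
    by (auto simp: M'_def prob prob_space_return)
  interpret product_sigma_finite M'
    using M' by (simp add: product_sigma_finite_def prob_space_imp_sigma_finite)
  have eq: "PiM I M = PiM I M'"
    by (rule PiM_cong) (auto simp: M'_def)
  have g: "integrable (M' i) (g i)" if "i \<in> I" for i
  proof (cases "i \<in> J")
    case True
    then show ?thesis using int that by (simp add: g_def M'_def)
  next
    case False
    interpret prob_space "M' i" by (rule M')
    show ?thesis using False by (simp add: g_def)
  qed
  have prod_eq: "(\<Prod>i\<in>I. h i) = (\<Prod>i\<in>J. h i)" if "\<And>i. i \<in> I - J \<Longrightarrow> h i = 1" for h :: "'i \<Rightarrow> real"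
    using that fin J by (intro prod.mono_neutral_right) auto
  have fg: "(\<Prod>i\<in>J. f i (x i)) = (\<Prod>i\<in>I. g i (x i))" for x
    by (subst prod_eq) (auto simp: g_def)
  show "integrable (PiM I M) (\<lambda>x. \<Prod>i\<in>J. f i (x i))"
    unfolding eq fg by (rule product_integrable_prod[OF fin g])
  have one: "integral\<^sup>L (M' i) (g i) = 1" if "i \<in> I - J" for i
  proof -
    interpret prob_space "M' i" by (rule M')
    show ?thesis using that by (simp add: g_def prob_space)
  qed
  have "(\<integral>x. (\<Prod>i\<in>J. f i (x i)) \<partial>PiM I M) = (\<Prod>i\<in>I. integral\<^sup>L (M' i) (g i))"
    unfolding eq fg by (rule product_integral_prod[OF fin g])
  also have "\<dots> = (\<Prod>i\<in>J. integral\<^sup>L (M' i) (g i))"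
    by (rule prod_eq[OF one])
  also have "\<dots> = (\<Prod>i\<in>J. integral\<^sup>L (M i) (f i))"
    using J by (intro prod.cong) (auto simp: g_def M'_def)
  finally show "(\<integral>x. (\<Prod>i\<in>J. f i (x i)) \<partial>PiM I M) = (\<Prod>i\<in>J. integral\<^sup>L (M i) (f i))" .
qed

lemma integral_PiM_component:
  fixes f :: "'a \<Rightarrow> real"
  assumes "finite I" "\<And>i. i \<in> I \<Longrightarrow> prob_space (M i)" "j \<in> I" "integrable (M j) f"
  shows "integrable (PiM I M) (\<lambda>x. f (x j))"
    and "(\<integral>x. f (x j) \<partial>PiM I M) = integral\<^sup>L (M j) f"
  using integral_PiM_prod[of I M "{j}" "\<lambda>_. f"] assms by auto

lemma max_sum_1_le:
  fixes p :: "'a \<Rightarrow> real"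
  assumes "finite A" and nonneg: "\<And>j. j \<in> A \<Longrightarrow> 0 \<le> p j"
  shows "max (\<Sum>j\<in>A. p j) 1 \<le> (\<Sum>j\<in>A. p j) + (\<Prod>j\<in>A. 1 - min (p j) 1)"
proof -
  have "1 - (\<Sum>j\<in>A. min (p j) 1) \<le> (\<Prod>j\<in>A. 1 - min (p j) 1)"
    using nonneg by (intro Weierstrass_prod_ineq) auto
  moreover have "(\<Sum>j\<in>A. min (p j) 1) \<le> (\<Sum>j\<in>A. p j)"
    by (intro sum_mono) auto
  moreover have "0 \<le> (\<Prod>j\<in>A. 1 - min (p j) 1)"
    by (intro prod_nonneg) auto
  ultimately show ?thesis by auto
qed

lemma max_sum_1_ge:
  fixes p :: "'a \<Rightarrow> real"
  assumes fin: "finite A" and nonneg: "\<And>j. j \<in> A \<Longrightarrow> 0 \<le> p j"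
  shows "1 + (\<Sum>j\<in>A. max (p j - 1) 0) \<le> max (\<Sum>j\<in>A. p j) 1"
proof (cases "\<exists>j\<in>A. 1 \<le> p j")
  case True
  then obtain j where j: "j \<in> A" "1 \<le> p j" by blast
  have "1 \<le> (\<Sum>j\<in>A. min (p j) 1)"
    using member_le_sum[of j A "\<lambda>j. min (p j) 1"] j nonneg fin by auto
  moreover have "(\<Sum>j\<in>A. p j) = (\<Sum>j\<in>A. min (p j) 1) + (\<Sum>j\<in>A. max (p j - 1) 0)"
    unfolding sum.distrib[symmetric] by (intro sum.cong) auto
  ultimately show ?thesis by linarith
next
  case False
  then have "(\<Sum>j\<in>A. max (p j - 1) 0) = 0"
    by (intro sum.neutral) auto
  then show ?thesis by simp
qed

lemma sum_group_lessThan: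
  fixes f :: "nat \<Rightarrow> 'b::comm_monoid_add"
  assumes "\<And>j. j < n \<Longrightarrow> a j < (m::nat)"
  shows "(\<Sum>i<m. \<Sum>j | j < n \<and> a j = i. f j) = (\<Sum>j<n. f j)"
  using sum.group[of "{..<n}" "{..<m}" a f] assms by (auto simp: image_subset_iff)

text \<open>The witness comes from averaging: if every \<open>a j\<close> is drawn uniformly and independently, each
  factor of the inner product has mean \<open>1 - \<mu> j / m\<close>.\<close>

lemma ex_assignment_sum_prod_le:
  fixes \<mu> :: "nat \<Rightarrow> real" and n m :: nat
  assumes m: "0 < m" and \<mu>: "\<And>j. j < n \<Longrightarrow> \<mu> j \<le> 1"
  shows "\<exists>a \<in> {..<n} \<rightarrow>\<^sub>E {..<m}.
    (\<Sum>i<m. \<Prod>j | j < n \<and> a j = i. 1 - \<mu> j) \<le> m * exp (- (\<Sum>j<n. \<mu> j) / m)"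
proof (rule ccontr)
  let ?A = "{..<n} \<rightarrow>\<^sub>E {..<m}"
  let ?f = "\<lambda>a. \<Sum>i<m. \<Prod>j | j < n \<and> a j = i. 1 - \<mu> j"
  let ?c = "m * exp (- (\<Sum>j<n. \<mu> j) / m)"
  assume "\<not> ?thesis"
  then have gt: "?c < ?f a" if "a \<in> ?A" for a
    using that by force
  have fin: "finite ?A" by (rule finite_PiE) simp_all
  have ne: "?A \<noteq> {}" using m by (auto simp: PiE_eq_empty_iff)
  have card: "card ?A = m ^ n" by (simp add: card_PiE)
  have inner: "(\<Sum>i'<m. if i' = i then 1 - \<mu> j else 1) = m * (1 - \<mu> j / m)" if "i < m" for i j
  proof -
    have "(\<Sum>i'<m. if i' = i then 1 - \<mu> j else 1) = (\<Sum>i'<m. 1 - (if i' = i then \<mu> j else 0))"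
      by (intro sum.cong) auto
    also have "\<dots> = m - \<mu> j" using that by (simp add: sum_subtractf)
    also have "\<dots> = m * (1 - \<mu> j / m)" using m by (simp add: field_simps)
    finally show ?thesis .
  qed
  have "(\<Sum>a\<in>?A. ?f a) = (\<Sum>i<m. \<Sum>a\<in>?A. \<Prod>j | j < n \<and> a j = i. 1 - \<mu> j)"
    by (rule sum.swap)
  also have "\<dots> = (\<Sum>i<m. \<Sum>a\<in>?A. \<Prod>j<n. if a j = i then 1 - \<mu> j else 1)"
    by (intro sum.cong refl prod.mono_neutral_cong_left) auto
  also have "\<dots> = (\<Sum>i<m. \<Prod>j<n. \<Sum>i'<m. if i' = i then 1 - \<mu> j else 1)"
    by (subst prod_sum_PiE) auto
  also have "\<dots> = (\<Sum>i<m. \<Prod>j<n. m * (1 - \<mu> j / m))"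
    by (intro sum.cong prod.cong inner) auto
  also have "\<dots> = m ^ n * (m * (\<Prod>j<n. 1 - \<mu> j / m))"
    by (simp add: prod.distrib)
  also have "(\<Prod>j<n. 1 - \<mu> j / m) \<le> (\<Prod>j<n. exp (- (\<mu> j / m)))"
  proof (intro prod_mono conjI)
    fix j assume "j \<in> {..<n}"
    then have "\<mu> j \<le> m" using \<mu>[of j] m by (auto intro: order_trans[of _ 1])
    then show "0 \<le> 1 - \<mu> j / m" using m by (simp add: field_simps)
    show "1 - \<mu> j / m \<le> exp (- (\<mu> j / m))"
      using exp_ge_add_one_self[of "- (\<mu> j / m)"] by simp
  qed
  also have "\<dots> = exp (- (\<Sum>j<n. \<mu> j) / m)"
    by (simp add: exp_sum[symmetric] sum_negf sum_divide_distrib)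
  finally have "(\<Sum>a\<in>?A. ?f a) \<le> m ^ n * ?c"
    by (simp add: mult_left_mono)
  moreover have "(\<Sum>a\<in>?A. ?c) < (\<Sum>a\<in>?A. ?f a)"
    by (rule sum_strict_mono[OF fin ne gt])
  ultimately show False by (simp add: card)
qed

lemma sum_durations_le_workload:
  assumes feas: "feasible n m p S" and p: "\<And>j. j < n \<Longrightarrow> 0 \<le> p j"
  shows "(\<Sum>j | j < n \<and> machine S j = i. p j) \<le> workload n p S i"
proof -
  let ?A = "{j. j < n \<and> machine S j = i}"
  let ?I = "\<lambda>j. {start S j ..< start S j + p j}"
  let ?W = "workload n p S i"
  have fin: "finite (insert 0 {start S j + p j | j. j < n \<and> machine S j = i})"
    by (auto simp: setcompr_eq_image)
  have W0: "0 \<le> ?W" unfolding workload_def using fin by (intro Max_ge) auto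
  have W: "start S j + p j \<le> ?W" if "j \<in> ?A" for j
    unfolding workload_def using that fin by (intro Max_ge) auto
  have "(\<Sum>j\<in>?A. p j) = (\<Sum>j\<in>?A. measure lborel (?I j))"
    using p by (intro sum.cong) auto
  also have "\<dots> = measure lborel (\<Union>j\<in>?A. ?I j)"
  proof (intro measure_finite_Union[symmetric])
    show "disjoint_family_on ?I ?A"
      using feas unfolding feasible_def disjoint_family_on_def by blast
  qed (use p in auto)
  also have "\<dots> \<le> measure lborel {0..?W}"
  proof (rule measure_mono_fmeasurable)
    show "(\<Union>j\<in>?A. ?I j) \<subseteq> {0..?W}"
      using feas W unfolding feasible_def by fastforce
  qed (use W0 in \<open>auto simp: fmeasurable_def\<close>)
  also have "\<dots> = ?W" using W0 by simp
  finally show ?thesis .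
qed

lemma realizations_nonneg: "p \<in> realizations n \<Longrightarrow> j < n \<Longrightarrow> 0 \<le> p j"
  by (auto simp: realizations_def PiE_def Pi_def)

lemma joint_law_realizations:
  assumes "sebp_instance I"
  shows "AE p in joint_law I. p \<in> realizations (njobs I)"
proof -
  have "AE p in joint_law I. \<forall>j\<in>{..<njobs I}. 0 \<le> p j"
    unfolding joint_law_def
    using assms by (intro AE_finite_allI AE_PiM_component) (auto simp: sebp_instance_def)
  moreover have "AE p in joint_law I. p \<in> extensional {..<njobs I}"
    by (intro AE_I2) (auto simp: joint_law_def space_PiM PiE_def)
  ultimately show ?thesis
    by eventually_elim (auto simp: realizations_def PiE_def)
qed

context
  fixes I :: sebp
  assumes inst: "sebp_instance I"
begin

lemma prob_space_joint_law: "prob_space (joint_law I)"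
  unfolding joint_law_def using inst by (intro prob_space_PiM) (auto simp: sebp_instance_def)

lemma integral_joint_law_component:
  fixes f :: "real \<Rightarrow> real"
  assumes "j < njobs I" "integrable (law I j) f"
  shows "integrable (joint_law I) (\<lambda>p. f (p j))"
    and "(\<integral>p. f (p j) \<partial>joint_law I) = integral\<^sup>L (law I j) f"
  unfolding joint_law_def
  using inst assms by (auto intro!: integral_PiM_component simp: sebp_instance_def)

lemma integral_joint_law_prod:
  fixes f :: "nat \<Rightarrow> real \<Rightarrow> real"
  assumes "J \<subseteq> {..<njobs I}" "\<And>j. j \<in> J \<Longrightarrow> integrable (law I j) (f j)"
  shows "integrable (joint_law I) (\<lambda>p. \<Prod>j\<in>J. f j (p j))"
    and "(\<integral>p. (\<Prod>j\<in>J. f j (p j)) \<partial>joint_law I) = (\<Prod>j\<in>J. integral\<^sup>L (law I j) (f j))"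
  unfolding joint_law_def
  using inst assms by (auto intro!: integral_PiM_prod simp: sebp_instance_def)

lemma integrable_law:
  assumes "j < njobs I"
  shows "integrable (law I j) (\<lambda>x. x)" "integrable (law I j) (\<lambda>x. min x 1)"
    "integrable (law I j) (\<lambda>x. max (x - 1) 0)"
proof -
  interpret prob_space "law I j" using inst assms by (auto simp: sebp_instance_def)
  show *: "integrable (law I j) (\<lambda>x. x)" using inst assms by (auto simp: sebp_instance_def)
  show "integrable (law I j) (\<lambda>x. min x 1)" "integrable (law I j) (\<lambda>x. max (x - 1) 0)"
    using * by (auto intro!: integrable_min integrable_max)
qed

lemma OPT_F_le:
  defines "\<mu> \<equiv> \<lambda>j. \<integral>x. min x 1 \<partial>law I j"
  shows "OPT_F I \<le> ennreal ((\<Sum>j<njobs I. \<integral>x. x \<partial>law I j) +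
           nmachines I * exp (- (\<Sum>j<njobs I. \<mu> j) / nmachines I))"
proof -
  let ?n = "njobs I" and ?m = "nmachines I"
  have \<mu>: "\<mu> j \<le> 1" if "j < ?n" for j
  proof -
    interpret prob_space "law I j" using inst that by (auto simp: sebp_instance_def)
    have "\<mu> j \<le> (\<integral>x. 1 \<partial>law I j)"
      unfolding \<mu>_def by (intro integral_mono integrable_law that) auto
    then show ?thesis by (simp add: prob_space)
  qed
  have "0 < ?m" using inst by (simp add: sebp_instance_def)
  from ex_assignment_sum_prod_le[OF this \<mu>] obtain a where a: "a \<in> {..<?n} \<rightarrow>\<^sub>E {..<?m}"
    and le: "(\<Sum>i<?m. \<Prod>j | j < ?n \<and> a j = i. 1 - \<mu> j) \<le> ?m * exp (- (\<Sum>j<?n. \<mu> j) / ?m)"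
    by (rule bexE)
  have a': "a j < ?m" if "j < ?n" for j using a that by auto
  have cost_i: "(\<integral>\<^sup>+ p. ennreal (max (\<Sum>j\<in>A. p j) 1) \<partial>joint_law I)
      \<le> ennreal ((\<Sum>j\<in>A. \<integral>x. x \<partial>law I j) + (\<Prod>j\<in>A. 1 - \<mu> j))"
    if A: "A \<subseteq> {..<?n}" for A
  proof -
    have fin: "finite A" using A finite_subset by blast
    let ?g = "\<lambda>p. (\<Sum>j\<in>A. p j) + (\<Prod>j\<in>A. 1 - min (p j) 1)"
    have int1: "integrable (joint_law I) (\<lambda>p. \<Sum>j\<in>A. p j)"
      using A by (intro Bochner_Integration.integrable_sum
          integral_joint_law_component(1)[of _ "\<lambda>x. x"] integrable_law) auto
    have int: "integrable (law I j) (\<lambda>x. 1 - min x 1)" if "j < ?n" for j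
    proof -
      interpret prob_space "law I j" using inst that by (auto simp: sebp_instance_def)
      show ?thesis using integrable_law(2)[OF that] by simp
    qed
    have int2: "integrable (joint_law I) (\<lambda>p. \<Prod>j\<in>A. 1 - min (p j) 1)"
      using A by (intro integral_joint_law_prod(1)[where f="\<lambda>_ x. 1 - min x 1"] int) auto
    have nonneg: "0 \<le> ?g p" if "p \<in> realizations ?n" for p
      using that A
      by (intro add_nonneg_nonneg sum_nonneg prod_nonneg) (auto intro: realizations_nonneg)
    have "(\<integral>\<^sup>+ p. ennreal (max (\<Sum>j\<in>A. p j) 1) \<partial>joint_law I) \<le> (\<integral>\<^sup>+ p. ennreal (?g p) \<partial>joint_law I)"
    proof (rule nn_integral_mono_AE)
      show "AE p in joint_law I. ennreal (max (\<Sum>j\<in>A. p j) 1) \<le> ennreal (?g p)"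
        using joint_law_realizations[OF inst]
      proof eventually_elim
        case (elim p)
        then show ?case
          using A fin by (intro ennreal_leI max_sum_1_le) (auto intro: realizations_nonneg)
      qed
    qed
    also have "\<dots> = ennreal (\<integral>p. ?g p \<partial>joint_law I)"
      by (intro nn_integral_eq_integral Bochner_Integration.integrable_add int1 int2)
        (use joint_law_realizations[OF inst] nonneg in \<open>auto elim!: eventually_mono\<close>)
    also have "(\<integral>p. ?g p \<partial>joint_law I) = (\<integral>p. (\<Sum>j\<in>A. p j) \<partial>joint_law I) +
        (\<integral>p. (\<Prod>j\<in>A. 1 - min (p j) 1) \<partial>joint_law I)"
      by (intro Bochner_Integration.integral_add int1 int2)
    also have "(\<integral>p. (\<Sum>j\<in>A. p j) \<partial>joint_law I) = (\<Sum>j\<in>A. \<integral>x. x \<partial>law I j)"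
      using A
      by (subst Bochner_Integration.integral_sum)
        (auto intro!: sum.cong integral_joint_law_component[where f="\<lambda>x. x"] integrable_law)
    also have "(\<integral>p. (\<Prod>j\<in>A. 1 - min (p j) 1) \<partial>joint_law I) = (\<Prod>j\<in>A. \<integral>x. 1 - min x 1 \<partial>law I j)"
      using A by (intro integral_joint_law_prod(2)[where f="\<lambda>_ x. 1 - min x 1"] int) auto
    also have "\<dots> = (\<Prod>j\<in>A. 1 - \<mu> j)"
    proof (intro prod.cong refl)
      fix j assume "j \<in> A"
      then have j: "j < ?n" using A by auto
      interpret prob_space "law I j" using inst j by (auto simp: sebp_instance_def)
      show "(\<integral>x. 1 - min x 1 \<partial>law I j) = 1 - \<mu> j"
        unfolding \<mu>_def using integrable_law(2)[OF j]
        by (simp add: prob_space)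
    qed
    finally show ?thesis .
  qed
  have E: "0 \<le> (\<integral>x. x \<partial>law I j)" if "j < ?n" for j
    using that inst by (intro integral_nonneg_AE) (auto simp: sebp_instance_def)
  have "OPT_F I \<le> fixed_cost I a"
    unfolding OPT_F_def by (rule INF_lower[OF a])
  also have "\<dots> \<le> (\<Sum>i<?m. ennreal ((\<Sum>j | j < ?n \<and> a j = i. \<integral>x. x \<partial>law I j) +
      (\<Prod>j | j < ?n \<and> a j = i. 1 - \<mu> j)))"
    unfolding fixed_cost_def by (intro sum_mono cost_i) auto
  also have "\<dots> = ennreal (\<Sum>i<?m. (\<Sum>j | j < ?n \<and> a j = i. \<integral>x. x \<partial>law I j) +
      (\<Prod>j | j < ?n \<and> a j = i. 1 - \<mu> j))"
    using \<mu> E by (intro sum_ennreal add_nonneg_nonneg sum_nonneg prod_nonneg) auto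
  also have "\<dots> = ennreal ((\<Sum>j<?n. \<integral>x. x \<partial>law I j) + (\<Sum>i<?m. \<Prod>j | j < ?n \<and> a j = i. 1 - \<mu> j))"
    by (simp add: sum.distrib sum_group_lessThan[OF a'])
  also have "\<dots> \<le> ennreal ((\<Sum>j<?n. \<integral>x. x \<partial>law I j) + ?m * exp (- (\<Sum>j<?n. \<mu> j) / ?m))"
    using le by (intro ennreal_leI) simp
  finally show ?thesis .
qed

lemma OPT_P_ge:
  shows "ennreal (nmachines I + (\<Sum>j<njobs I. \<integral>x. max (x - 1) 0 \<partial>law I j)) \<le> OPT_P I"
    and "ennreal (\<Sum>j<njobs I. \<integral>x. x \<partial>law I j) \<le> OPT_P I"
proof -
  let ?n = "njobs I" and ?m = "nmachines I"
  interpret prob_space "joint_law I" by (rule prob_space_joint_law)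
  have ge: "ennreal (expectation g) \<le> OPT_P I"
    if int: "integrable (joint_law I) g"
      and g0: "\<And>p. p \<in> realizations ?n \<Longrightarrow> 0 \<le> g p"
      and g: "\<And>p S. p \<in> realizations ?n \<Longrightarrow> feasible ?n ?m p S \<Longrightarrow>
        g p \<le> (\<Sum>i<?m. max (\<Sum>j | j < ?n \<and> machine S j = i. p j) 1)" for g
    unfolding OPT_P_def
  proof (rule INF_greatest)
    fix \<pi> assume "\<pi> \<in> {\<pi>. policy ?n ?m \<pi>}"
    then have feas: "feasible ?n ?m p (\<pi> p)" if "p \<in> realizations ?n" for p
      using that by (auto simp: policy_def)
    have "ennreal (expectation g) = (\<integral>\<^sup>+ p. ennreal (g p) \<partial>joint_law I)"
      by (intro nn_integral_eq_integral[symmetric] int)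
        (use joint_law_realizations[OF inst] g0 in \<open>auto elim!: eventually_mono\<close>)
    also have "\<dots> \<le> cost I \<pi>"
      unfolding cost_def
    proof (rule nn_integral_mono_AE)
      show "AE p in joint_law I. ennreal (g p) \<le>
          ennreal (\<Sum>i<?m. max (workload ?n p (\<pi> p) i) 1)"
        using joint_law_realizations[OF inst]
      proof eventually_elim
        case (elim p)
        have "g p \<le> (\<Sum>i<?m. max (\<Sum>j | j < ?n \<and> machine (\<pi> p) j = i. p j) 1)"
          using elim feas by (intro g)
        also have "\<dots> \<le> (\<Sum>i<?m. max (workload ?n p (\<pi> p) i) 1)"
          using elim
          by (intro sum_mono max.mono sum_durations_le_workload[OF feas] order_refl)
            (auto intro: realizations_nonneg)
        finally show ?case by (rule ennreal_leI)
      qed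
    qed
    finally show "ennreal (expectation g) \<le> cost I \<pi>" .
  qed
  have mach: "machine S j < ?m" if "feasible ?n ?m p S" "j < ?n" for p S j
    using that by (auto simp: feasible_def)
  have int1: "integrable (joint_law I) (\<lambda>p. max (p j - 1) 0)" if "j < ?n" for j
    using that by (intro integral_joint_law_component(1)[where f="\<lambda>x. max (x - 1) 0"] integrable_law)
  have int2: "integrable (joint_law I) (\<lambda>p. p j)" if "j < ?n" for j
    using that by (intro integral_joint_law_component(1)[where f="\<lambda>x. x"] integrable_law)
  have "ennreal (expectation (\<lambda>p. ?m + (\<Sum>j<?n. max (p j - 1) 0))) \<le> OPT_P I"
  proof (rule ge)
    show "integrable (joint_law I) (\<lambda>p. ?m + (\<Sum>j<?n. max (p j - 1) 0))"
      by (intro Bochner_Integration.integrable_add Bochner_Integration.integrable_sum int1) auto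
    show "0 \<le> ?m + (\<Sum>j<?n. max (p j - 1) 0)" for p :: "nat \<Rightarrow> real"
      by (intro add_nonneg_nonneg sum_nonneg) auto
    fix p S assume p: "p \<in> realizations ?n" and S: "feasible ?n ?m p S"
    have "?m + (\<Sum>j<?n. max (p j - 1) 0) =
        (\<Sum>i<?m. 1 + (\<Sum>j | j < ?n \<and> machine S j = i. max (p j - 1) 0))"
      by (simp add: sum.distrib sum_group_lessThan[OF mach[OF S]])
    also have "\<dots> \<le> (\<Sum>i<?m. max (\<Sum>j | j < ?n \<and> machine S j = i. p j) 1)"
      by (intro sum_mono max_sum_1_ge) (auto intro: realizations_nonneg[OF p])
    finally show "?m + (\<Sum>j<?n. max (p j - 1) 0) \<le>
      (\<Sum>i<?m. max (\<Sum>j | j < ?n \<and> machine S j = i. p j) 1)" .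
  qed
  also have "expectation (\<lambda>p. ?m + (\<Sum>j<?n. max (p j - 1) 0)) =
      ?m + (\<Sum>j<?n. \<integral>x. max (x - 1) 0 \<partial>law I j)"
    using int1 integral_joint_law_component(2)[where f="\<lambda>x. max (x - 1) 0"] integrable_law(3)
    by (subst Bochner_Integration.integral_add)
      (auto simp: prob_space intro!: Bochner_Integration.integrable_sum)
  finally show "ennreal (?m + (\<Sum>j<?n. \<integral>x. max (x - 1) 0 \<partial>law I j)) \<le> OPT_P I" .
  have "ennreal (expectation (\<lambda>p. \<Sum>j<?n. p j)) \<le> OPT_P I"
  proof (rule ge)
    show "integrable (joint_law I) (\<lambda>p. \<Sum>j<?n. p j)"
      by (intro Bochner_Integration.integrable_sum int2) auto
    show "0 \<le> (\<Sum>j<?n. p j)" if "p \<in> realizations ?n" for p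
      using realizations_nonneg[OF that] by (intro sum_nonneg) auto
    fix p S assume p: "p \<in> realizations ?n" and S: "feasible ?n ?m p S"
    have "(\<Sum>j<?n. p j) = (\<Sum>i<?m. \<Sum>j | j < ?n \<and> machine S j = i. p j)"
      by (simp add: sum_group_lessThan[OF mach[OF S]])
    also have "\<dots> \<le> (\<Sum>i<?m. max (\<Sum>j | j < ?n \<and> machine S j = i. p j) 1)"
      by (intro sum_mono) auto
    finally show "(\<Sum>j<?n. p j) \<le> (\<Sum>i<?m. max (\<Sum>j | j < ?n \<and> machine S j = i. p j) 1)" .
  qed
  also have "expectation (\<lambda>p. \<Sum>j<?n. p j) = (\<Sum>j<?n. \<integral>x. x \<partial>law I j)"
    using int2 integral_joint_law_component(2)[where f="\<lambda>x. x"] integrable_law(1)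
    by simp
  finally show "ennreal (\<Sum>j<?n. \<integral>x. x \<partial>law I j) \<le> OPT_P I" .
qed

end

lemma add_exp_neg_le:
  fixes x :: real
  assumes "0 \<le> x" "x \<le> 1"
  shows "x + exp (- x) \<le> 1 + exp (- 1)"
proof -
  have "exp (- x) * (1 + (x - 1)) \<le> exp (- x) * exp (x - 1)"
    by (intro mult_left_mono exp_ge_add_one_self) auto
  also have "\<dots> = exp (- 1)"
    by (simp add: exp_add[symmetric])
  finally have "exp (- x) - exp (- 1) \<le> exp (- x) * (1 - x)"
    by (simp add: algebra_simps)
  also have "\<dots> \<le> 1 * (1 - x)"
    using assms by (intro mult_right_mono) auto
  finally show ?thesis by simp
qed

lemma load_bound:
  fixes T E M m :: real
  assumes "0 \<le> E" "0 \<le> M" "0 < m" "T = E + M"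
  shows "T + m * exp (- M / m) \<le> (1 + exp (- 1)) * max (m + E) T"
proof (cases "M \<le> m")
  case True
  have "M / m + exp (- (M / m)) \<le> 1 + exp (- 1)"
    using assms True by (intro add_exp_neg_le) auto
  then have "m * (M / m + exp (- (M / m))) \<le> m * (1 + exp (- 1))"
    using assms by (intro mult_left_mono) auto
  then have "T + m * exp (- M / m) \<le> E + m * (1 + exp (- 1))"
    using assms by (simp add: distrib_left)
  also have "\<dots> \<le> (1 + exp (- 1)) * (m + E)"
    using assms by (simp add: algebra_simps)
  also have "\<dots> \<le> (1 + exp (- 1)) * max (m + E) T"
    by (intro mult_left_mono) auto
  finally show ?thesis .
next
  case False
  have "m * exp (- M / m) \<le> T * exp (- 1)"
    using assms False by (intro mult_mono) (auto simp: field_simps)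
  then have "T + m * exp (- M / m) \<le> (1 + exp (- 1)) * T"
    by (simp add: algebra_simps)
  also have "\<dots> \<le> (1 + exp (- 1)) * max (m + E) T"
    by (intro mult_left_mono) auto
  finally show ?thesis .
qed

lemma OPT_F_le_OPT_P:
  assumes "sebp_instance I"
  shows "OPT_F I \<le> ennreal (1 + exp (- 1)) * OPT_P I"
proof -
  let ?n = "njobs I" and ?m = "nmachines I"
  define T where "T = (\<Sum>j<?n. \<integral>x. x \<partial>law I j)"
  define E where "E = (\<Sum>j<?n. \<integral>x. max (x - 1) 0 \<partial>law I j)"
  define M where "M = (\<Sum>j<?n. \<integral>x. min x 1 \<partial>law I j)"
  have T: "T = E + M"
    unfolding T_def E_def M_def sum.distrib[symmetric]
  proof (intro sum.cong refl)
    fix j assume "j \<in> {..<?n}"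
    then have "(\<integral>x. max (x - 1) 0 + min x 1 \<partial>law I j)
        = (\<integral>x. max (x - 1) 0 \<partial>law I j) + (\<integral>x. min x 1 \<partial>law I j)"
      by (intro Bochner_Integration.integral_add integrable_law[OF assms]) auto
    also have "(\<lambda>x::real. max (x - 1) 0 + min x 1) = (\<lambda>x. x)" by auto
    finally show "(\<integral>x. x \<partial>law I j)
        = (\<integral>x. max (x - 1) 0 \<partial>law I j) + (\<integral>x. min x 1 \<partial>law I j)" .
  qed
  have "0 \<le> E" unfolding E_def by (intro sum_nonneg integral_nonneg) auto
  have "0 \<le> M" unfolding M_def
    using assms by (intro sum_nonneg integral_nonneg_AE) (auto simp: sebp_instance_def elim!: eventually_mono)
  have "0 < real ?m" using assms by (simp add: sebp_instance_def)
  have "OPT_F I \<le> ennreal (T + ?m * exp (- M / ?m))"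
    unfolding T_def M_def by (rule OPT_F_le[OF assms])
  also have "\<dots> \<le> ennreal ((1 + exp (- 1)) * max (?m + E) T)"
    by (intro ennreal_leI load_bound) fact+
  also have "\<dots> = ennreal (1 + exp (- 1)) * max (ennreal (?m + E)) (ennreal T)"
    by (simp add: ennreal_mult' max_of_mono[of ennreal] monoI ennreal_leI del: ennreal_plus)
  also have "\<dots> \<le> ennreal (1 + exp (- 1)) * OPT_P I"
    unfolding E_def T_def using OPT_P_ge[OF assms] by (intro mult_left_mono max.boundedI) auto
  finally show ?thesis .
qed

subsection \<open>Bernoulli jobs and the lower bound\<close>

definition bernoulli_law :: "nat \<Rightarrow> real measure" where
  "bernoulli_law N = distr (measure_pmf (bernoulli_pmf (1 / N))) borel of_bool"

lemma prob_space_bernoulli_law: "prob_space (bernoulli_law N)"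
  unfolding bernoulli_law_def by (intro prob_space.prob_space_distr prob_space_measure_pmf) auto

lemma sets_bernoulli_law [simp]: "sets (bernoulli_law N) = sets borel"
  by (simp add: bernoulli_law_def)

lemma AE_bernoulli_law: "AE x in bernoulli_law N. x \<in> {0, 1}"
  unfolding bernoulli_law_def by (subst AE_distr_iff) (auto simp: AE_measure_pmf_iff)

lemma integral_bernoulli_law:
  fixes f :: "real \<Rightarrow> real"
  assumes f: "f \<in> borel_measurable borel"
  shows "integrable (bernoulli_law N) f"
    and "1 \<le> N \<Longrightarrow> integral\<^sup>L (bernoulli_law N) f = f 1 / N + f 0 * (1 - 1 / N)"
proof -
  show "integrable (bernoulli_law N) f"
    unfolding bernoulli_law_def
    using f by (subst integrable_distr_eq) (auto intro: integrable_measure_pmf_finite)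
  show "integral\<^sup>L (bernoulli_law N) f = f 1 / N + f 0 * (1 - 1 / N)" if "1 \<le> N"
    unfolding bernoulli_law_def using f that by (subst integral_distr) auto
qed

definition bernoulli_instance :: "nat \<Rightarrow> nat \<Rightarrow> sebp" where
  "bernoulli_instance N m = \<lparr>njobs = N * m, nmachines = m, law = \<lambda>_. bernoulli_law N\<rparr>"

lemma bernoulli_instance_simps [simp]:
  "njobs (bernoulli_instance N m) = N * m"
  "nmachines (bernoulli_instance N m) = m"
  "law (bernoulli_instance N m) j = bernoulli_law N"
  by (simp_all add: bernoulli_instance_def)

lemma sebp_instance_bernoulli:
  assumes "0 < m"
  shows "sebp_instance (bernoulli_instance N m)"
proof -
  have "AE x in bernoulli_law N. 0 \<le> x"
    using AE_bernoulli_law by eventually_elim auto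
  then show ?thesis
    unfolding sebp_instance_def bernoulli_instance_simps
    using assms by (auto simp: prob_space_bernoulli_law integral_bernoulli_law(1))
qed

lemma AE_bernoulli_instance:
  "AE p in joint_law (bernoulli_instance N m). \<forall>j\<in>{..<N * m}. p j \<in> {0, 1}"
  unfolding joint_law_def bernoulli_instance_simps
  by (intro AE_finite_allI AE_PiM_component prob_space_bernoulli_law)
    (use AE_bernoulli_law in auto)

lemma max_sum_1_binary:
  fixes p :: "'a \<Rightarrow> real"
  assumes "finite A" and "\<And>j. j \<in> A \<Longrightarrow> p j \<in> {0, 1}"
  shows "max (\<Sum>j\<in>A. p j) 1 = (\<Sum>j\<in>A. p j) + (\<Prod>j\<in>A. 1 - p j)"
proof (cases "\<exists>j\<in>A. p j = 1")
  case True
  then obtain j where j: "j \<in> A" "p j = 1" by blast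
  then have "1 \<le> (\<Sum>j\<in>A. p j)"
    using member_le_sum[of j A p] assms by force
  moreover have "(\<Prod>j\<in>A. 1 - p j) = 0"
    using j assms by (intro prod_zero) auto
  ultimately show ?thesis by simp
next
  case False
  then have "p j = 0" if "j \<in> A" for j using assms(2)[OF that] that by auto
  then show ?thesis by simp
qed

lemma sum_power_ge:
  fixes c :: real and k :: "nat \<Rightarrow> nat"
  assumes c: "0 < c" and k: "(\<Sum>i<m. k i) = N * m"
  shows "m * c ^ N \<le> (\<Sum>i<m. c ^ k i)"
proof -
  have "c ^ N * (1 + (real (k i) - N) * ln c) \<le> c ^ k i" for i
  proof -
    have "c ^ N * (1 + (real (k i) - N) * ln c) \<le> c ^ N * exp ((real (k i) - N) * ln c)"
      using c by (intro mult_left_mono exp_ge_add_one_self) auto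
    also have "\<dots> = exp (N * ln c) * exp ((real (k i) - N) * ln c)"
      using c by (simp add: exp_of_nat_mult)
    also have "\<dots> = exp (k i * ln c)"
      by (simp add: exp_add[symmetric] algebra_simps)
    also have "\<dots> = c ^ k i"
      using c by (simp add: exp_of_nat_mult)
    finally show ?thesis .
  qed
  then have "(\<Sum>i<m. c ^ N * (1 + (real (k i) - N) * ln c)) \<le> (\<Sum>i<m. c ^ k i)"
    by (intro sum_mono)
  moreover have "(\<Sum>i<m. c ^ N * (1 + (real (k i) - N) * ln c)) =
      c ^ N * (m + (real (\<Sum>i<m. k i) - N * m) * ln c)"
    by (simp add: sum_distrib_left[symmetric] sum.distrib sum_distrib_right[symmetric] sum_subtractf)
  ultimately show ?thesis by (simp add: k mult.commute)
qed

lemma OPT_F_bernoulli_ge: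
  assumes N: "2 \<le> N" and m: "0 < m"
  shows "ennreal (m * (1 + (1 - 1 / N) ^ N)) \<le> OPT_F (bernoulli_instance N m)"
  unfolding OPT_F_def
proof (rule INF_greatest)
  let ?I = "bernoulli_instance N m"
  let ?c = "1 - 1 / real N"
  fix a assume "a \<in> {..<njobs ?I} \<rightarrow>\<^sub>E {..<nmachines ?I}"
  then have a: "a j < m" if "j < N * m" for j using that by auto
  note inst = sebp_instance_bernoulli[OF m, of N]
  let ?A = "\<lambda>i. {j. j < N * m \<and> a j = i}"
  have c: "0 < ?c" using N by simp
  have cost_i: "(\<integral>\<^sup>+ p. ennreal (max (\<Sum>j\<in>A. p j) 1) \<partial>joint_law ?I)
      = ennreal (card A / N + ?c ^ card A)"
    if A: "A \<subseteq> {..<N * m}" for A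
  proof -
    have fin: "finite A" using A finite_subset by blast
    let ?g = "\<lambda>p. (\<Sum>j\<in>A. p j) + (\<Prod>j\<in>A. 1 - p j)"
    have AE: "AE p in joint_law ?I. max (\<Sum>j\<in>A. p j) 1 = ?g p"
      using AE_bernoulli_instance[of N m]
      by eventually_elim (use A fin in \<open>auto intro!: max_sum_1_binary\<close>)
    have int: "integrable (joint_law ?I) (\<lambda>p. p j)" "(\<integral>p. p j \<partial>joint_law ?I) = 1 / N"
      if "j \<in> A" for j
      using integral_joint_law_component[OF inst, of j "\<lambda>x. x"] that A N
      by (auto simp: integral_bernoulli_law)
    have intp: "integrable (joint_law ?I) (\<lambda>p. \<Prod>j\<in>A. 1 - p j)"
      "(\<integral>p. (\<Prod>j\<in>A. 1 - p j) \<partial>joint_law ?I) = ?c ^ card A"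
      using integral_joint_law_prod[OF inst, of A "\<lambda>_ x. 1 - x"] A N
      by (auto simp: integral_bernoulli_law prob_space.prob_space[OF prob_space_bernoulli_law])
    have "(\<integral>\<^sup>+ p. ennreal (max (\<Sum>j\<in>A. p j) 1) \<partial>joint_law ?I) = (\<integral>\<^sup>+ p. ennreal (?g p) \<partial>joint_law ?I)"
      by (rule nn_integral_cong_AE) (use AE in \<open>auto elim!: eventually_mono\<close>)
    also have "\<dots> = ennreal (\<integral>p. ?g p \<partial>joint_law ?I)"
    proof (intro nn_integral_eq_integral Bochner_Integration.integrable_add
        Bochner_Integration.integrable_sum int intp)
      show "AE p in joint_law ?I. 0 \<le> ?g p"
        using AE by eventually_elim linarith
    qed
    also have "(\<integral>p. ?g p \<partial>joint_law ?I) = card A / N + ?c ^ card A"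
      using int intp by (subst Bochner_Integration.integral_add) auto
    finally show ?thesis .
  qed
  have card: "(\<Sum>i<m. card (?A i)) = N * m"
    using sum_group_lessThan[of "N * m" a m "\<lambda>_. 1::nat"] a by simp
  have "m * (1 + ?c ^ N) \<le> m + (\<Sum>i<m. ?c ^ card (?A i))"
    using sum_power_ge[OF c card] by (simp add: distrib_left)
  also have "\<dots> = (\<Sum>i<m. card (?A i) / N + ?c ^ card (?A i))"
  proof -
    have "(\<Sum>i<m. card (?A i) / N) = real (\<Sum>i<m. card (?A i)) / N"
      by (simp add: sum_divide_distrib)
    also have "\<dots> = m" using N unfolding card by simp
    finally show ?thesis by (simp add: sum.distrib)
  qed
  finally have "ennreal (m * (1 + ?c ^ N)) \<le> ennreal (\<Sum>i<m. card (?A i) / N + ?c ^ card (?A i))"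
    by (rule ennreal_leI)
  also have "\<dots> = (\<Sum>i<m. ennreal (card (?A i) / N + ?c ^ card (?A i)))"
    using c by (intro sum_ennreal[symmetric] add_nonneg_nonneg zero_le_power) auto
  also have "\<dots> = fixed_cost ?I a"
    unfolding fixed_cost_def bernoulli_instance_simps by (intro sum.cong cost_i[symmetric]) auto
  finally show "ennreal (m * (1 + ?c ^ N)) \<le> fixed_cost ?I a" .
qed

text \<open>The policy: run the jobs at time \<open>0\<close> on machine \<open>0\<close> until one of positive duration shows up,
  then on machine \<open>1\<close>, and so on; once all machines are occupied, the remaining jobs are appended to
  machine \<open>0\<close>.\<close>

definition occupied :: "(nat \<Rightarrow> real) \<Rightarrow> nat \<Rightarrow> nat" where
  "occupied p j = (\<Sum>k<j. if 0 < p k then 1 else 0)"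

definition adaptive_machine :: "nat \<Rightarrow> (nat \<Rightarrow> real) \<Rightarrow> nat \<Rightarrow> nat" where
  "adaptive_machine m p j = (if occupied p j < m then occupied p j else 0)"

definition load0 :: "nat \<Rightarrow> (nat \<Rightarrow> real) \<Rightarrow> nat \<Rightarrow> real" where
  "load0 m p j = (\<Sum>k<j. if adaptive_machine m p k = 0 then p k else 0)"

definition adaptive_start :: "nat \<Rightarrow> (nat \<Rightarrow> real) \<Rightarrow> nat \<Rightarrow> real" where
  "adaptive_start m p j = (if occupied p j < m then 0 else load0 m p j)"

definition adaptive :: "nat \<Rightarrow> (nat \<Rightarrow> real) \<Rightarrow> schedule" where
  "adaptive m p = \<lparr>start = adaptive_start m p, machine = adaptive_machine m p\<rparr>"

lemma adaptive_simps [simp]: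
  "start (adaptive m p) = adaptive_start m p" "machine (adaptive m p) = adaptive_machine m p"
  by (simp_all add: adaptive_def)

lemma occupied_Suc [simp]: "occupied p (Suc j) = occupied p j + (if 0 < p j then 1 else 0)"
  by (simp add: occupied_def)

lemma occupied_mono: "j \<le> k \<Longrightarrow> occupied p j \<le> occupied p k"
  by (rule lift_Suc_mono_le[of "occupied p"]) simp_all

lemma load0_Suc [simp]:
  "load0 m p (Suc j) = load0 m p j + (if adaptive_machine m p j = 0 then p j else 0)"
  by (simp add: load0_def)

lemma load0_mono:
  assumes p: "p \<in> realizations n" and "j \<le> k" "k \<le> n"
  shows "load0 m p j \<le> load0 m p k"
  unfolding load0_def using assms realizations_nonneg[OF p] by (intro sum_mono2) auto

lemma load0_nonneg: "p \<in> realizations n \<Longrightarrow> j \<le> n \<Longrightarrow> 0 \<le> load0 m p j"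
  using load0_mono[of p n 0 j m] by (simp add: load0_def)

lemma adaptive_start_mono:
  assumes p: "p \<in> realizations n" and "j \<le> k" "k \<le> n"
  shows "adaptive_start m p j \<le> adaptive_start m p k"
  using occupied_mono[OF \<open>j \<le> k\<close>, of p] load0_mono[OF assms, of m] load0_nonneg[OF p \<open>k \<le> n\<close>, of m]
  by (auto simp: adaptive_start_def)

lemma adaptive_completion_le:
  assumes p: "p \<in> realizations n" and j: "j < n" and 0: "adaptive_machine m p j = 0"
  shows "adaptive_start m p j + p j \<le> load0 m p (Suc j)"
  using 0 load0_nonneg[OF p less_imp_le[OF j], of m] by (auto simp: adaptive_start_def)

lemma feasible_adaptive:
  assumes m: "0 < m" and p: "p \<in> realizations n"
  shows "feasible n m p (adaptive m p)"
proof -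
  have disj: "{adaptive_start m p j ..< adaptive_start m p j + p j} \<inter>
      {adaptive_start m p k ..< adaptive_start m p k + p k} = {}"
    if jk: "j < k" "k < n" and eq: "adaptive_machine m p j = adaptive_machine m p k" for j k
  proof (cases "occupied p k < m")
    case True
    have "occupied p (Suc j) \<le> occupied p k" using jk by (intro occupied_mono) auto
    then have "\<not> 0 < p j"
      using eq True by (auto simp: adaptive_machine_def split: if_splits)
    then show ?thesis by auto
  next
    case False
    then have "adaptive_machine m p j = 0" using eq by (simp add: adaptive_machine_def)
    then have "adaptive_start m p j + p j \<le> load0 m p (Suc j)"
      using jk by (intro adaptive_completion_le[OF p]) auto
    also have "\<dots> \<le> load0 m p k" using jk by (intro load0_mono[OF p]) auto
    also have "\<dots> = adaptive_start m p k" using False by (simp add: adaptive_start_def)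
    finally show ?thesis by auto
  qed
  have "{adaptive_start m p j ..< adaptive_start m p j + p j} \<inter>
      {adaptive_start m p k ..< adaptive_start m p k + p k} = {}"
    if "j < n" "k < n" "j \<noteq> k" "adaptive_machine m p j = adaptive_machine m p k" for j k
    using disj[of j k] disj[of k j] that by (cases "j < k") (auto simp: Int_commute)
  moreover have "0 \<le> adaptive_start m p j" if "j < n" for j
    using load0_nonneg[OF p, of j m] that by (auto simp: adaptive_start_def)
  moreover have "adaptive_machine m p j < m" for j
    using m by (auto simp: adaptive_machine_def)
  ultimately show ?thesis by (auto simp: feasible_def)
qed

lemma non_anticipatory_adaptive: "non_anticipatory n (adaptive m)"
proof -
  let ?h = "\<lambda>p. history n p (adaptive m p) (\<lambda>j. j)"
  let ?d = "\<lambda>p. decision n (adaptive m p) (\<lambda>j. j)"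
  have key: "adaptive_start m q k = t \<and> adaptive_machine m q k = adaptive_machine m p k"
    if p: "p \<in> realizations n" and q: "q \<in> realizations n" and h: "?h p t k = ?h q t k"
      and k: "k < n" and t: "adaptive_start m p k = t" for p q t k
  proof -
    have *: "adaptive_machine m q j = adaptive_machine m p j"
      "(0 < p j) = (0 < q j)"
      "adaptive_start m p j + p j \<le> t \<Longrightarrow> p j = q j" if j: "j < k" for j
    proof -
      have start: "adaptive_start m p j \<le> t"
        unfolding t[symmetric] using j k by (intro adaptive_start_mono[OF p]) auto
      then have "?h p t k j = Some (adaptive_start m p j, j, adaptive_machine m p j,
          if adaptive_start m p j + p j \<le> t then Some (p j) else None)"
        using j k by (auto simp: history_def)
      then have "?h q t k j = Some (adaptive_start m p j, j, adaptive_machine m p j,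
          if adaptive_start m p j + p j \<le> t then Some (p j) else None)"
        using h by simp
      then have "adaptive_start m q j = adaptive_start m p j"
        and mach: "adaptive_machine m q j = adaptive_machine m p j"
        and fin: "(if adaptive_start m p j + q j \<le> t then Some (q j) else None)
          = (if adaptive_start m p j + p j \<le> t then Some (p j) else None)"
        by (auto simp: history_def split: if_splits)
      show "adaptive_machine m q j = adaptive_machine m p j" by (rule mach)
      show "(0 < p j) = (0 < q j)" using fin start by (auto split: if_splits)
      show "p j = q j" if "adaptive_start m p j + p j \<le> t"
        using fin that by (auto split: if_splits)
    qed
    have occ: "occupied q k = occupied p k"
      unfolding occupied_def using * by (intro sum.cong) auto
    have "load0 m q k = load0 m p k" if "\<not> occupied p k < m"
      unfolding load0_def
    proof (intro sum.cong refl)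
      fix j assume "j \<in> {..<k}"
      then have j: "j < k" by simp
      have "p j = q j" if 0: "adaptive_machine m p j = 0"
      proof (rule *(3)[OF j])
        have "adaptive_start m p j + p j \<le> load0 m p (Suc j)"
          using j k by (intro adaptive_completion_le[OF p _ 0]) auto
        also have "\<dots> \<le> load0 m p k" using j k by (intro load0_mono[OF p]) auto
        also have "\<dots> = t" using t \<open>\<not> occupied p k < m\<close> by (simp add: adaptive_start_def)
        finally show "adaptive_start m p j + p j \<le> t" .
      qed
      then show "(if adaptive_machine m q j = 0 then q j else 0)
          = (if adaptive_machine m p j = 0 then p j else 0)"
        using *(1)[OF j] by simp
    qed
    then show ?thesis
      using t occ by (auto simp: adaptive_start_def adaptive_machine_def)
  qed
  have "?d p t k = ?d q t k"
    if "p \<in> realizations n" "q \<in> realizations n" "?h p t k = ?h q t k" for p q t k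
    using key[of p q t k] key[of q p t k] that by (auto simp: decision_def)
  then show ?thesis
    unfolding non_anticipatory_def by (intro exI[of _ "\<lambda>_ j. j"]) blast
qed

lemma policy_adaptive:
  assumes "0 < m"
  shows "policy n m (adaptive m)"
proof -
  let ?B = "PiM {..<n} (\<lambda>_. borel :: real measure)"
  have comp [measurable]: "(\<lambda>p. p k) \<in> borel_measurable ?B" if "k < n" for k
    using that by simp
  have occ [measurable]: "(\<lambda>p. occupied p j) \<in> ?B \<rightarrow>\<^sub>M count_space UNIV" if "j \<le> n" for j
    using that
  proof (induction j)
    case (Suc j)
    then have [measurable]: "(\<lambda>p. occupied p j) \<in> ?B \<rightarrow>\<^sub>M count_space UNIV"
      "(\<lambda>p. p j) \<in> borel_measurable ?B" by auto
    have "(\<lambda>p. if 0 < p j then Suc (occupied p j) else occupied p j) \<in> ?B \<rightarrow>\<^sub>M count_space UNIV"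
      by measurable
    also have "(\<lambda>p. if 0 < p j then Suc (occupied p j) else occupied p j) = (\<lambda>p. occupied p (Suc j))"
      by auto
    finally show ?case .
  qed (simp add: occupied_def)
  have mach [measurable]: "(\<lambda>p. adaptive_machine m p j) \<in> ?B \<rightarrow>\<^sub>M count_space UNIV" if "j < n" for j
  proof -
    have [measurable]: "(\<lambda>p. occupied p j) \<in> ?B \<rightarrow>\<^sub>M count_space UNIV"
      using that by (intro occ) auto
    show ?thesis unfolding adaptive_machine_def by measurable
  qed
  have "(\<lambda>p. adaptive_start m p j) \<in> ?B \<rightarrow>\<^sub>M borel" if "j < n" for j
  proof -
    have [measurable]: "(\<lambda>p. occupied p j) \<in> ?B \<rightarrow>\<^sub>M count_space UNIV"
      using that by (intro occ) auto
    have [measurable]: "(\<lambda>p. load0 m p j) \<in> ?B \<rightarrow>\<^sub>M borel"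
      unfolding load0_def
    proof (intro borel_measurable_sum)
      fix k assume "k \<in> {..<j}"
      then have "k < n" using that by simp
      note [measurable] = comp[OF this] mach[OF this]
      show "(\<lambda>p. if adaptive_machine m p k = 0 then p k else 0) \<in> borel_measurable ?B"
        by measurable
    qed
    show ?thesis unfolding adaptive_start_def by measurable
  qed
  then show ?thesis
    using mach feasible_adaptive[OF assms] non_anticipatory_adaptive by (simp add: policy_def)
qed

lemma load0_le:
  assumes "0 < m" and "\<And>k. k < j \<Longrightarrow> p k \<in> {0, 1}"
  shows "load0 m p j \<le> (if occupied p j = 0 then 0 else 1 + real (occupied p j - m))"
  using assms(2)
proof (induction j)
  case 0
  then show ?case by (simp add: load0_def)
next
  case (Suc j)
  then have "load0 m p j \<le> (if occupied p j = 0 then 0 else 1 + real (occupied p j - m))"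
    and "p j \<in> {0, 1}" by auto
  then show ?case
    using \<open>0 < m\<close> by (auto simp: adaptive_machine_def split: if_splits)
qed

lemma sum_workload_adaptive_le:
  assumes m: "0 < m" and p: "p \<in> realizations n" and bin: "\<And>j. j < n \<Longrightarrow> p j \<in> {0, 1}"
  shows "(\<Sum>i<m. max (workload n p (adaptive m p) i) 1) \<le> m + max ((\<Sum>j<n. p j) - m) 0"
proof -
  let ?W = "workload n p (adaptive m p)"
  have W_le: "?W i \<le> c"
    if "0 \<le> c" "\<And>j. j < n \<Longrightarrow> adaptive_machine m p j = i \<Longrightarrow> adaptive_start m p j + p j \<le> c" for i c
    unfolding workload_def using that
    by (intro Max.boundedI) (auto simp: setcompr_eq_image)
  have "real (occupied p n) = (\<Sum>j<n. p j)"
    unfolding occupied_def of_nat_sum using bin by (intro sum.cong) fastforce+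
  then have "load0 m p n \<le> 1 + max ((\<Sum>j<n. p j) - m) 0"
    using load0_le[OF m, of n p] bin by (cases "m \<le> occupied p n") (auto split: if_splits)
  moreover have "?W 0 \<le> load0 m p n"
  proof (rule W_le)
    fix j assume j: "j < n" "adaptive_machine m p j = 0"
    then have "adaptive_start m p j + p j \<le> load0 m p (Suc j)"
      by (intro adaptive_completion_le[OF p])
    also have "\<dots> \<le> load0 m p n" using j by (intro load0_mono[OF p]) auto
    finally show "adaptive_start m p j + p j \<le> load0 m p n" .
  qed (rule load0_nonneg[OF p order_refl])
  ultimately have W0: "max (?W 0) 1 \<le> 1 + max ((\<Sum>j<n. p j) - m) 0" by auto
  have W: "?W i \<le> 1" if "i \<noteq> 0" for i
  proof (rule W_le)
    fix j assume j: "j < n" "adaptive_machine m p j = i"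
    then have "adaptive_start m p j = 0"
      using that by (auto simp: adaptive_machine_def adaptive_start_def split: if_splits)
    then show "adaptive_start m p j + p j \<le> 1" using bin[OF j(1)] by auto
  qed simp
  have "(\<Sum>i<m. max (?W i) 1) = max (?W 0) 1 + (\<Sum>i\<in>{..<m} - {0}. max (?W i) 1)"
    using m by (intro sum.remove) auto
  also have "(\<Sum>i\<in>{..<m} - {0}. max (?W i) 1) = (\<Sum>i\<in>{..<m} - {0}. 1)"
    using W by (intro sum.cong) (auto simp: max_def)
  also have "\<dots> = real m - 1" using m by (simp add: of_nat_diff)
  finally show ?thesis using W0 by simp
qed

lemma OPT_P_bernoulli_le:
  assumes N: "1 \<le> N" and s: "0 < s"
  shows "OPT_P (bernoulli_instance N (s\<^sup>2)) \<le> ennreal (s\<^sup>2 + s)"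
proof -
  let ?m = "s\<^sup>2" and ?I = "bernoulli_instance N (s\<^sup>2)"
  let ?n = "N * ?m"
  let ?\<mu> = "1 / real N"
  have m: "0 < ?m" using s by simp
  note inst = sebp_instance_bernoulli[OF m, of N]
  interpret prob_space "joint_law ?I" by (rule prob_space_joint_law[OF inst])
  let ?D = "\<lambda>p. (\<Sum>j<?n. p j - ?\<mu>)\<^sup>2"
  have D: "?D p = (\<Sum>j<?n. \<Sum>k<?n. (p j - ?\<mu>) * (p k - ?\<mu>))" for p :: "nat \<Rightarrow> real"
    by (simp add: power2_eq_square sum_product)
  have cross: "integrable (joint_law ?I) (\<lambda>p. (p j - ?\<mu>) * (p k - ?\<mu>))"
    "expectation (\<lambda>p. (p j - ?\<mu>) * (p k - ?\<mu>)) \<le> (if j = k then ?\<mu> else 0)"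
    if "j < ?n" "k < ?n" for j k
  proof -
    have "integrable (joint_law ?I) (\<lambda>p. (p j - ?\<mu>) * (p k - ?\<mu>)) \<and>
      expectation (\<lambda>p. (p j - ?\<mu>) * (p k - ?\<mu>)) \<le> (if j = k then ?\<mu> else 0)"
    proof (cases "j = k")
      case True
      have sum_sq: "(1 - x) * (1 - x) * x + x * x * (1 - x) = x * (1 - x)" for x :: real
        by algebra
      have "(1 - ?\<mu>) * (1 - ?\<mu>) / N + ?\<mu> * ?\<mu> * (1 - ?\<mu>) = ?\<mu> * (1 - ?\<mu>)"
        using sum_sq[of ?\<mu>] by simp
      also have "\<dots> \<le> ?\<mu>" by (simp add: algebra_simps)
      finally show ?thesis
        using True that N
          integral_joint_law_component[OF inst, of j "\<lambda>x. (x - ?\<mu>) * (x - ?\<mu>)"]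
        by (auto simp: integral_bernoulli_law)
    next
      case False
      have "(\<integral>x. x - ?\<mu> \<partial>bernoulli_law N) = 0"
        using N by (subst integral_bernoulli_law(2)) (auto simp: field_simps)
      with False show ?thesis
        using that integral_joint_law_prod[OF inst, of "{j, k}" "\<lambda>_ x. x - ?\<mu>"]
        by (simp add: integral_bernoulli_law(1) del: Bochner_Integration.integral_diff)
    qed
    then show "integrable (joint_law ?I) (\<lambda>p. (p j - ?\<mu>) * (p k - ?\<mu>))"
      "expectation (\<lambda>p. (p j - ?\<mu>) * (p k - ?\<mu>)) \<le> (if j = k then ?\<mu> else 0)" by auto
  qed
  have intD: "integrable (joint_law ?I) ?D"
    unfolding D by (intro Bochner_Integration.integrable_sum cross) auto
  have "expectation ?D = (\<Sum>j<?n. \<Sum>k<?n. expectation (\<lambda>p. (p j - ?\<mu>) * (p k - ?\<mu>)))"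
    unfolding D using cross
    by (subst Bochner_Integration.integral_sum, force intro!: Bochner_Integration.integrable_sum)
      (intro sum.cong refl Bochner_Integration.integral_sum, auto)
  also have "\<dots> \<le> (\<Sum>j<?n. \<Sum>k<?n. if j = k then ?\<mu> else 0)"
    by (intro sum_mono cross) auto
  also have "\<dots> = ?m" using N by simp
  finally have ED: "expectation ?D \<le> s\<^sup>2" by simp
  let ?g = "\<lambda>p. s\<^sup>2 + (?D p / s + s) / 2"
  have intg: "integrable (joint_law ?I) ?g"
    using intD by (intro Bochner_Integration.integrable_add integrable_divide) auto
  have "OPT_P ?I \<le> cost ?I (adaptive ?m)"
    unfolding OPT_P_def using policy_adaptive[OF m] by (intro INF_lower) auto
  also have "\<dots> \<le> (\<integral>\<^sup>+ p. ennreal (?g p) \<partial>joint_law ?I)"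
    unfolding cost_def
  proof (rule nn_integral_mono_AE)
    show "AE p in joint_law ?I. ennreal (\<Sum>i<nmachines ?I. max (workload (njobs ?I) p (adaptive ?m p) i) 1)
        \<le> ennreal (?g p)"
      using AE_bernoulli_instance[of N ?m] joint_law_realizations[OF inst]
    proof eventually_elim
      case (elim p)
      let ?y = "(\<Sum>j<?n. p j) - ?m"
      have "(\<Sum>i<?m. max (workload ?n p (adaptive ?m p) i) 1) \<le> ?m + max ?y 0"
        using elim by (intro sum_workload_adaptive_le[OF m]) auto
      also have "max ?y 0 \<le> (?y\<^sup>2 / s + s) / 2"
      proof -
        have "0 \<le> (?y - s)\<^sup>2" by simp
        then have "?y * s \<le> (?y\<^sup>2 + s * s) / 2" by (simp add: power2_eq_square algebra_simps)
        then have "?y \<le> (?y\<^sup>2 / s + s) / 2" using s by (simp add: field_simps)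
        moreover have "0 \<le> (?y\<^sup>2 / s + s) / 2" by simp
        ultimately show ?thesis by (rule max.boundedI)
      qed
      also have "?y = (\<Sum>j<?n. p j - ?\<mu>)" using N by (simp add: sum_subtractf)
      finally show ?case by (intro ennreal_leI) simp
    qed
  qed
  also have "\<dots> = ennreal (expectation ?g)"
    using intg by (intro nn_integral_eq_integral) auto
  also have "expectation ?g = s\<^sup>2 + (expectation ?D / s + s) / 2"
    using intD by (simp add: prob_space)
  also have "\<dots> \<le> s\<^sup>2 + s"
  proof -
    have "expectation ?D / s \<le> s" using ED s by (simp add: field_simps power2_eq_square)
    then show ?thesis by simp
  qed
  finally show ?thesis by (simp add: ennreal_leI)
qed

lemma ennreal_inverse_antimono: "a \<le> b \<Longrightarrow> inverse b \<le> inverse a" for a b :: ennreal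
  including ennreal.lifting by transfer (rule ereal_inverse_antimono)

theorem theorem4:
  "(SUP I \<in> {I :: sebp. sebp_instance I}. OPT_F I / OPT_P I) = ennreal (1 + exp (- 1))"
proof (rule antisym)
  show "(SUP I \<in> {I :: sebp. sebp_instance I}. OPT_F I / OPT_P I) \<le> ennreal (1 + exp (- 1))"
  proof (rule SUP_least)
    fix I :: sebp assume "I \<in> {I. sebp_instance I}"
    then have inst: "sebp_instance I" by simp
    have "0 < ennreal (nmachines I)" using inst by (simp add: sebp_instance_def)
    also have "\<dots> \<le> ennreal (nmachines I + (\<Sum>j<njobs I. \<integral>x. max (x - 1) 0 \<partial>law I j))"
      by (intro ennreal_leI) (simp add: sum_nonneg integral_nonneg)
    also have "\<dots> \<le> OPT_P I" by (rule OPT_P_ge(1)[OF inst])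
    finally show "OPT_F I / OPT_P I \<le> ennreal (1 + exp (- 1))"
      using OPT_F_le_OPT_P[OF inst] by (intro divide_le_posI_ennreal) (auto simp: mult.commute)
  qed
next
  let ?S = "SUP I \<in> {I :: sebp. sebp_instance I}. OPT_F I / OPT_P I"
  let ?r = "\<lambda>s. (1 + (1 + (- 1) / real s) ^ s) / (1 + 1 / real s)"
  have le: "ennreal (?r s) \<le> ?S" if s: "2 \<le> s" for s
  proof -
    let ?I = "bernoulli_instance s (s\<^sup>2)"
    have "s\<^sup>2 + s = s\<^sup>2 * (1 + 1 / real s)"
      using s by (simp add: power2_eq_square distrib_left)
    then have "a / (1 + 1 / s) = s\<^sup>2 * a / (s\<^sup>2 + s)" for a :: real
      using s by simp
    then have "ennreal (?r s) = ennreal (s\<^sup>2 * (1 + (1 - 1 / s) ^ s) / (s\<^sup>2 + s))"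
      by simp
    also have "\<dots> = ennreal (s\<^sup>2 * (1 + (1 - 1 / s) ^ s)) / ennreal (s\<^sup>2 + s)"
      using s
      by (intro divide_ennreal[symmetric] mult_nonneg_nonneg add_nonneg_nonneg) (auto intro: add_pos_pos)
    also have "\<dots> \<le> OPT_F ?I / OPT_P ?I"
      using OPT_F_bernoulli_ge[of s "s\<^sup>2"] OPT_P_bernoulli_le[of s s] s
      unfolding divide_ennreal_def by (intro mult_mono ennreal_inverse_antimono) auto
    also have "\<dots> \<le> ?S"
      using s sebp_instance_bernoulli[of "s\<^sup>2" s] by (intro SUP_upper) auto
    finally show ?thesis .
  qed
  have "(\<lambda>s. ?r s) \<longlonglongrightarrow> (1 + exp (- 1)) / (1 + 0)"
    by (intro tendsto_intros tendsto_exp_limit_sequentially lim_1_over_n) simp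
  then have "(\<lambda>s. ennreal (?r s)) \<longlonglongrightarrow> ennreal (1 + exp (- 1))"
    by (intro tendsto_ennrealI) simp
  then show "ennreal (1 + exp (- 1)) \<le> ?S"
    by (rule LIMSEQ_le_const2) (use le in auto)
qed

end
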